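(* For any $k$ and any simplified stateless $k$-counter machine $M=(\Sigma,u,F)$ there is a sentence of $\mathsf{FOC}[+;\mathsf{MOD}]$ (over the alphabet $\Sigma$) that defines the same language that $M$ recognizes.
   Context: **The logic $\mathsf{FOC}[+;\mathsf{MOD}]$.** Fix a finite alphabet $\Sigma$. Formulas are interpreted in finite strings $w=w_1\cdots w_n\in\Sigma^*$. There are two sorts. Position variables $p,q,\dots$ range over integers in $[1,n]$. Count variables $x,y,z,\dots$ range over the rational numbers; count terms are $c_0+c_1x_1+\dots+c_kx_k$ with rational constants $c_i$ and count variables $x_i$. Formulas are: $\top$ (true), $\bot$ (false); $Q_a(p)$ for $a\in\Sigma$, true iff $w_p=a$; $\mathsf{MOD}^r_m(p)$ for integers $r\ge0$, $m>0$, true iff $p\equiv r \pmod m$; $t_1=t_2$ and $t_1<t_2$ for count terms $t_1,t_2$; $\phi_1\land\phi_2$, $\phi_1\lor\phi_2$, $\neg\phi_1$; $\exists x.\phi$ and $\forall x.\phi$ for a count variable $x$ (quantifying over the rationals); and $\exists^{=x}p.\phi$ for a count variable $x$ and position variable $p$, true iff $\phi$ is true for exactly $x$ values of $p\in[1,n]$ (this binds $p$ but leaves $x$ free). A sentence is a formula with no free variables. The language defined by a sentence $\sigma$ is $\{w\in\Sigma^*\mid w\models\sigma\}$. **Simplified stateless counter machines.** A simplified stateless $k$-counter machine ($k$-SSCM) is a tuple $M=(\Sigma,u,F)$ where $\Sigma$ is a finite alphabet, $u\colon\Sigma\to\mathbb Z^k$ is a counter update function, and $F\in\{0,1\}^k$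 is an acceptance mask. $M$ accepts $w=w_1\cdots w_n$ if there is a sequence $c_0,\dots,c_n\in\mathbb Z^k$ such that $c_0=\mathbf 0$, $c_i=c_{i-1}+u(w_i)$ for all $i\in[1,n]$, and for every $i\in[1,k]$, $[c_n]_i=0$ iff $F_i=0$. $M$ recognizes $L$ if $L=\{w\in\Sigma^*\mid M\text{ accepts }w\}$. *)

theory Defs
  imports Complex_Main "HOL-Number_Theory.Cong"
begin

section \<open>The logic FOC[+;MOD]\<close>

text \<open>The two sorts of variables are kept apart by the constructors in which they occur, each with
  its own assignment, so both can be named by natural numbers.\<close>

type_synonym pvar = nat
type_synonym cvar = nat

text \<open>\<open>CTerm c\<^sub>0 [(c\<^sub>1, x\<^sub>1), \<dots>, (c\<^sub>k, x\<^sub>k)]\<close> stands for \<open>c\<^sub>0 + c\<^sub>1 x\<^sub>1 + \<dots> + c\<^sub>k x\<^sub>k\<close>.\<close>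

datatype cterm = CTerm rat "(rat \<times> cvar) list"

text \<open>\<open>ExCount x p \<phi>\<close> is \<open>\<exists>\<^sup>=\<^sup>xp. \<phi>\<close>.\<close>

datatype 'a foc =
    Top
  | Bot
  | Letter 'a pvar
  | Modulo nat nat pvar
  | EqT cterm cterm
  | LessT cterm cterm
  | And "'a foc" "'a foc"
  | Or "'a foc" "'a foc"
  | Neg "'a foc"
  | Ex cvar "'a foc"
  | All cvar "'a foc"
  | ExCount cvar pvar "'a foc"

primrec eval :: "(cvar \<Rightarrow> rat) \<Rightarrow> cterm \<Rightarrow> rat" where
  "eval \<beta> (CTerm c cs) = c + (\<Sum>(d, x)\<leftarrow>cs. d * \<beta> x)"

primrec cvars :: "cterm \<Rightarrow> cvar set" where
  "cvars (CTerm c cs) = snd ` set cs"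

text \<open>Positions of a string are numbered from 1 while lists are indexed from 0. Position assignments
  are total functions whose values are not restricted to the positions of \<open>w\<close>; only values in
  \<open>{1..length w}\<close> are meaningful, and the quantifier \<open>ExCount\<close> produces only such values.\<close>

primrec sat :: "'a list \<Rightarrow> (pvar \<Rightarrow> nat) \<Rightarrow> (cvar \<Rightarrow> rat) \<Rightarrow> 'a foc \<Rightarrow> bool" where
  "sat w \<alpha> \<beta> Top \<longleftrightarrow> True"
| "sat w \<alpha> \<beta> Bot \<longleftrightarrow> False"
| "sat w \<alpha> \<beta> (Letter a p) \<longleftrightarrow> w ! (\<alpha> p - 1) = a"
| "sat w \<alpha> \<beta> (Modulo r m p) \<longleftrightarrow> [\<alpha> p = r] (mod m)"
| "sat w \<alpha> \<beta> (EqT s t) \<longleftrightarrow> eval \<beta> s = eval \<beta> t"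
| "sat w \<alpha> \<beta> (LessT s t) \<longleftrightarrow> eval \<beta> s < eval \<beta> t"
| "sat w \<alpha> \<beta> (And \<phi> \<psi>) \<longleftrightarrow> sat w \<alpha> \<beta> \<phi> \<and> sat w \<alpha> \<beta> \<psi>"
| "sat w \<alpha> \<beta> (Or \<phi> \<psi>) \<longleftrightarrow> sat w \<alpha> \<beta> \<phi> \<or> sat w \<alpha> \<beta> \<psi>"
| "sat w \<alpha> \<beta> (Neg \<phi>) \<longleftrightarrow> \<not> sat w \<alpha> \<beta> \<phi>"
| "sat w \<alpha> \<beta> (Ex x \<phi>) \<longleftrightarrow> (\<exists>v. sat w \<alpha> (\<beta>(x := v)) \<phi>)"
| "sat w \<alpha> \<beta> (All x \<phi>) \<longleftrightarrow> (\<forall>v. sat w \<alpha> (\<beta>(x := v)) \<phi>)"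
| "sat w \<alpha> \<beta> (ExCount x p \<phi>) \<longleftrightarrow>
     of_nat (card {i \<in> {1..length w}. sat w (\<alpha>(p := i)) \<beta> \<phi>}) = \<beta> x"

primrec free_pvars :: "'a foc \<Rightarrow> pvar set" where
  "free_pvars Top = {}"
| "free_pvars Bot = {}"
| "free_pvars (Letter a p) = {p}"
| "free_pvars (Modulo r m p) = {p}"
| "free_pvars (EqT s t) = {}"
| "free_pvars (LessT s t) = {}"
| "free_pvars (And \<phi> \<psi>) = free_pvars \<phi> \<union> free_pvars \<psi>"
| "free_pvars (Or \<phi> \<psi>) = free_pvars \<phi> \<union> free_pvars \<psi>"
| "free_pvars (Neg \<phi>) = free_pvars \<phi>"
| "free_pvars (Ex x \<phi>) = free_pvars \<phi>"
| "free_pvars (All x \<phi>) = free_pvars \<phi>"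
| "free_pvars (ExCount x p \<phi>) = free_pvars \<phi> - {p}"

primrec free_cvars :: "'a foc \<Rightarrow> cvar set" where
  "free_cvars Top = {}"
| "free_cvars Bot = {}"
| "free_cvars (Letter a p) = {}"
| "free_cvars (Modulo r m p) = {}"
| "free_cvars (EqT s t) = cvars s \<union> cvars t"
| "free_cvars (LessT s t) = cvars s \<union> cvars t"
| "free_cvars (And \<phi> \<psi>) = free_cvars \<phi> \<union> free_cvars \<psi>"
| "free_cvars (Or \<phi> \<psi>) = free_cvars \<phi> \<union> free_cvars \<psi>"
| "free_cvars (Neg \<phi>) = free_cvars \<phi>"
| "free_cvars (Ex x \<phi>) = free_cvars \<phi> - {x}"
| "free_cvars (All x \<phi>) = free_cvars \<phi> - {x}"
| "free_cvars (ExCount x p \<phi>) = insert x (free_cvars \<phi>)"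

text \<open>The constraints \<open>a \<in> \<Sigma>\<close> and \<open>m > 0\<close> that the datatype does not enforce.\<close>

primrec foc_formula :: "'a set \<Rightarrow> 'a foc \<Rightarrow> bool" where
  "foc_formula \<Sigma> Top \<longleftrightarrow> True"
| "foc_formula \<Sigma> Bot \<longleftrightarrow> True"
| "foc_formula \<Sigma> (Letter a p) \<longleftrightarrow> a \<in> \<Sigma>"
| "foc_formula \<Sigma> (Modulo r m p) \<longleftrightarrow> m > 0"
| "foc_formula \<Sigma> (EqT s t) \<longleftrightarrow> True"
| "foc_formula \<Sigma> (LessT s t) \<longleftrightarrow> True"
| "foc_formula \<Sigma> (And \<phi> \<psi>) \<longleftrightarrow> foc_formula \<Sigma> \<phi> \<and> foc_formula \<Sigma> \<psi>"
| "foc_formula \<Sigma> (Or \<phi> \<psi>) \<longleftrightarrow> foc_formula \<Sigma> \<phi> \<and> foc_formula \<Sigma> \<psi>"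
| "foc_formula \<Sigma> (Neg \<phi>) \<longleftrightarrow> foc_formula \<Sigma> \<phi>"
| "foc_formula \<Sigma> (Ex x \<phi>) \<longleftrightarrow> foc_formula \<Sigma> \<phi>"
| "foc_formula \<Sigma> (All x \<phi>) \<longleftrightarrow> foc_formula \<Sigma> \<phi>"
| "foc_formula \<Sigma> (ExCount x p \<phi>) \<longleftrightarrow> foc_formula \<Sigma> \<phi>"

definition foc_sentence :: "'a set \<Rightarrow> 'a foc \<Rightarrow> bool" where
  "foc_sentence \<Sigma> \<sigma> \<longleftrightarrow> foc_formula \<Sigma> \<sigma> \<and> free_pvars \<sigma> = {} \<and> free_cvars \<sigma> = {}"

lemma eval_cong: "(\<And>x. x \<in> cvars t \<Longrightarrow> \<beta> x = \<beta>' x) \<Longrightarrow> eval \<beta> t = eval \<beta>' t"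
  by (cases t) (force intro!: arg_cong[where f = sum_list] map_cong)

lemma sat_cong:
  assumes "\<And>p. p \<in> free_pvars \<phi> \<Longrightarrow> \<alpha> p = \<alpha>' p" "\<And>x. x \<in> free_cvars \<phi> \<Longrightarrow> \<beta> x = \<beta>' x"
  shows "sat w \<alpha> \<beta> \<phi> = sat w \<alpha>' \<beta>' \<phi>"
  using assms
proof (induction \<phi> arbitrary: \<alpha> \<alpha>' \<beta> \<beta>')
  case (EqT s t)
  then have "eval \<beta> s = eval \<beta>' s" "eval \<beta> t = eval \<beta>' t" by (auto intro!: eval_cong)
  then show ?case by simp
next
  case (LessT s t)
  then have "eval \<beta> s = eval \<beta>' s" "eval \<beta> t = eval \<beta>' t" by (auto intro!: eval_cong)
  then show ?case by simp
next
  case (And \<phi> \<psi>)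
  have "sat w \<alpha> \<beta> \<phi> = sat w \<alpha>' \<beta>' \<phi>" using And.prems by (intro And.IH) auto
  moreover have "sat w \<alpha> \<beta> \<psi> = sat w \<alpha>' \<beta>' \<psi>" using And.prems by (intro And.IH) auto
  ultimately show ?case by simp
next
  case (Or \<phi> \<psi>)
  have "sat w \<alpha> \<beta> \<phi> = sat w \<alpha>' \<beta>' \<phi>" using Or.prems by (intro Or.IH) auto
  moreover have "sat w \<alpha> \<beta> \<psi> = sat w \<alpha>' \<beta>' \<psi>" using Or.prems by (intro Or.IH) auto
  ultimately show ?case by simp
next
  case (Neg \<phi>)
  have "sat w \<alpha> \<beta> \<phi> = sat w \<alpha>' \<beta>' \<phi>" using Neg.prems by (intro Neg.IH) auto
  then show ?case by simp
next
  case (Ex x \<phi>)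
  have "sat w \<alpha> (\<beta>(x := v)) \<phi> = sat w \<alpha>' (\<beta>'(x := v)) \<phi>" for v
    using Ex.prems by (intro Ex.IH) auto
  then show ?case by simp
next
  case (All x \<phi>)
  have "sat w \<alpha> (\<beta>(x := v)) \<phi> = sat w \<alpha>' (\<beta>'(x := v)) \<phi>" for v
    using All.prems by (intro All.IH) auto
  then show ?case by simp
next
  case (ExCount x p \<phi>)
  have "sat w (\<alpha>(p := i)) \<beta> \<phi> = sat w (\<alpha>'(p := i)) \<beta>' \<phi>" for i
    using ExCount.prems by (intro ExCount.IH) auto
  then show ?case using ExCount.prems by simp
qed auto

definition models :: "'a list \<Rightarrow> 'a foc \<Rightarrow> bool" where
  "models w \<sigma> \<longleftrightarrow> (\<forall>\<alpha> \<beta>. sat w \<alpha> \<beta> \<sigma>)"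

text \<open>For a sentence the assignments in \<open>models\<close> are irrelevant.\<close>

lemma models_sentence:
  assumes "foc_sentence \<Sigma> \<sigma>"
  shows "models w \<sigma> \<longleftrightarrow> sat w \<alpha> \<beta> \<sigma>"
  using assms sat_cong[of \<sigma> _ \<alpha> _ \<beta> w] unfolding models_def foc_sentence_def by blast

definition foc_language :: "'a set \<Rightarrow> 'a foc \<Rightarrow> 'a list set" where
  "foc_language \<Sigma> \<sigma> = {w \<in> lists \<Sigma>. models w \<sigma>}"

section \<open>Simplified stateless counter machines\<close>

text \<open>Vectors in \<open>\<int>\<^sup>k\<close> and \<open>{0,1}\<^sup>k\<close> are functions on \<open>nat\<close> of which only the coordinates in \<open>{1..k}\<close>
  are used, and the update function is only used on the alphabet.\<close>

record 'a sscm =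
  alphabet :: "'a set"
  update :: "'a \<Rightarrow> nat \<Rightarrow> int"
  mask :: "nat \<Rightarrow> nat"

definition is_sscm :: "nat \<Rightarrow> 'a sscm \<Rightarrow> bool" where
  "is_sscm k M \<longleftrightarrow> finite (alphabet M) \<and> (\<forall>j\<in>{1..k}. mask M j \<in> {0, 1})"

definition sscm_accepts :: "nat \<Rightarrow> 'a sscm \<Rightarrow> 'a list \<Rightarrow> bool" where
  "sscm_accepts k M w \<longleftrightarrow> (\<exists>c :: nat \<Rightarrow> nat \<Rightarrow> int.
     (\<forall>j\<in>{1..k}. c 0 j = 0) \<and>
     (\<forall>i\<in>{1..length w}. \<forall>j\<in>{1..k}. c i j = c (i - 1) j + update M (w ! (i - 1)) j) \<and>
     (\<forall>j\<in>{1..k}. c (length w) j = 0 \<longleftrightarrow> mask M j = 0))"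

definition sscm_recognizes :: "nat \<Rightarrow> 'a sscm \<Rightarrow> 'a list set \<Rightarrow> bool" where
  "sscm_recognizes k M L \<longleftrightarrow> L = {w \<in> lists (alphabet M). sscm_accepts k M w}"

end

theory Submission
  imports Defs
begin

text \<open>A run of the machine is determined by the word, and its final \<open>j\<close>-th counter is
  \<open>\<Sum>\<^sub>a u(a)\<^sub>j n\<^sub>a\<close>, where \<open>n\<^sub>a\<close> is the number of occurrences of \<open>a\<close>. So it suffices to bind each
  \<open>n\<^sub>a\<close> to a count variable \<open>x\<^sub>a\<close>, as the only value for which exactly \<open>x\<^sub>a\<close> positions carry \<open>a\<close>,
  and to test linear equations in these variables. As the truth of a sentence does not depend on the
  assignment, we evaluate it under one that already maps every \<open>x\<^sub>a\<close> to \<open>n\<^sub>a\<close>; the quantifiers then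
  leave the assignment unchanged.\<close>

lemma sscm_accepts_iff_sum_list:
  "sscm_accepts k M w \<longleftrightarrow> (\<forall>j\<in>{1..k}. (\<Sum>a\<leftarrow>w. update M a j) = 0 \<longleftrightarrow> mask M j = 0)"
proof
  assume "sscm_accepts k M w"
  then obtain c where c: "\<forall>j\<in>{1..k}. c 0 j = 0"
      "\<forall>i\<in>{1..length w}. \<forall>j\<in>{1..k}. c i j = c (i - 1) j + update M (w ! (i - 1)) j"
      "\<forall>j\<in>{1..k}. c (length w) j = 0 \<longleftrightarrow> mask M j = 0"
    unfolding sscm_accepts_def by blast
  \<comment> \<open>The recurrence leaves no choice, so each configuration is the sum over a
    prefix.\<close>
  have "c i j = (\<Sum>a\<leftarrow>take i w. update M a j)" if "i \<le> length w" "j \<in> {1..k}" for i j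
    using that(1)
  proof (induction i)
    case 0
    then show ?case using c(1) that(2) by simp
  next
    case (Suc i)
    have "c (Suc i) j = c i j + update M (w ! i) j"
      using bspec[OF bspec[OF c(2), of "Suc i"] that(2)] Suc.prems by simp
    with Suc show ?case by (simp add: take_Suc_conv_app_nth)
  qed
  with c(3) show "\<forall>j\<in>{1..k}. (\<Sum>a\<leftarrow>w. update M a j) = 0 \<longleftrightarrow> mask M j = 0"
    by simp
next
  assume R: "\<forall>j\<in>{1..k}. (\<Sum>a\<leftarrow>w. update M a j) = 0 \<longleftrightarrow> mask M j = 0"
  \<comment> \<open>Conversely, the prefix sums themselves serve as the run.\<close>
  have "(\<Sum>a\<leftarrow>take i w. update M a j) =
      (\<Sum>a\<leftarrow>take (i - 1) w. update M a j) + update M (w ! (i - 1)) j"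
    if "i \<in> {1..length w}" for i j
    using that by (cases i) (simp_all add: take_Suc_conv_app_nth)
  with R show "sscm_accepts k M w"
    unfolding sscm_accepts_def
    by (intro exI[of _ "\<lambda>i j. \<Sum>a\<leftarrow>take i w. update M a j"]) simp
qed

text \<open>Groups the summands by letter. \<open>A\<close> may exceed \<open>set xs\<close>, as
  absent letters contribute 0; this lets one linear form over the whole alphabet serve all
  words.\<close>

lemma sum_list_map_eq_sum_count_list:
  fixes f :: "'a \<Rightarrow> 'b :: semiring_1"
  assumes "finite A" "set xs \<subseteq> A"
  shows "(\<Sum>x\<leftarrow>xs. f x) = (\<Sum>a\<in>A. of_nat (count_list xs a) * f a)"
  using assms(2)
proof (induction xs)
  case Nil
  then show ?case by simp
next
  case (Cons x xs)
  \<comment> \<open>Prepending \<open>x\<close> raises only the count of \<open>x\<close>, which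
    adds one \<open>f x\<close> because \<open>x\<close> lies in \<open>A\<close>.\<close>
  have "(\<Sum>a\<in>A. of_nat (count_list (x # xs) a) * f a)
      = (\<Sum>a\<in>A. (if a = x then f a else 0) + of_nat (count_list xs a) * f a)"
    by (intro sum.cong) (auto simp: algebra_simps)
  also have "\<dots> = f x + (\<Sum>a\<in>A. of_nat (count_list xs a) * f a)"
    using Cons.prems assms(1) by (simp add: sum.distrib)
  finally show ?case using Cons by simp
qed

text \<open>\<open>Suc\<close> translates 0-based list indices to the 1-based positions counted by
  \<open>ExCount\<close>.\<close>

lemma card_positions_eq_count_list:
  "card {i \<in> {1..length w}. w ! (i - 1) = a} = count_list w a"
proof -
  have "bij_betw Suc {i. i < length w \<and> w ! i = a} {i \<in> {1..length w}. w ! (i - 1) = a}"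
    by (rule bij_betw_byWitness[where f' = "\<lambda>i. i - 1"]) auto
  from bij_betw_same_card[OF this] show ?thesis
    by (simp add: count_list_eq_length_filter length_filter_conv_card eq_commute[of a])
qed

definition Conj :: "'a foc list \<Rightarrow> 'a foc" where
  "Conj \<phi>s = foldr And \<phi>s Top"

lemma sat_Conj [simp]: "sat w \<alpha> \<beta> (Conj \<phi>s) \<longleftrightarrow> (\<forall>\<phi>\<in>set \<phi>s. sat w \<alpha> \<beta> \<phi>)"
  by (induction \<phi>s) (auto simp: Conj_def)

lemma foc_formula_Conj [simp]: "foc_formula \<Sigma> (Conj \<phi>s) \<longleftrightarrow> (\<forall>\<phi>\<in>set \<phi>s. foc_formula \<Sigma> \<phi>)"
  by (induction \<phi>s) (auto simp: Conj_def)

lemma free_pvars_Conj [simp]: "free_pvars (Conj \<phi>s) = (\<Union>\<phi>\<in>set \<phi>s. free_pvars \<phi>)"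
  by (induction \<phi>s) (auto simp: Conj_def)

lemma free_cvars_Conj [simp]: "free_cvars (Conj \<phi>s) = (\<Union>\<phi>\<in>set \<phi>s. free_cvars \<phi>)"
  by (induction \<phi>s) (auto simp: Conj_def)

text \<open>\<open>ExCount\<close> leaves its count variable free, so an \<open>Ex\<close> around it
  closes the formula. All letters can share position variable 0, since each \<open>ExCount\<close>
  binds it immediately.\<close>

definition Bind_Counts :: "('a \<Rightarrow> cvar) \<Rightarrow> 'a list \<Rightarrow> 'a foc \<Rightarrow> 'a foc" where
  "Bind_Counts v as \<psi> = foldr (\<lambda>a \<phi>. Ex (v a) (And (ExCount (v a) 0 (Letter a 0)) \<phi>)) as \<psi>"

text \<open>The only witness for each \<open>Ex\<close> is the value that \<open>\<beta>\<close> has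
  there already, so the same \<open>\<beta>\<close> serves throughout the induction.\<close>

lemma sat_Bind_Counts:
  assumes "\<And>a. a \<in> set as \<Longrightarrow> \<beta> (v a) = of_nat (count_list w a)"
  shows "sat w \<alpha> \<beta> (Bind_Counts v as \<psi>) \<longleftrightarrow> sat w \<alpha> \<beta> \<psi>"
  using assms
proof (induction as)
  case Nil
  then show ?case by (simp add: Bind_Counts_def)
next
  case (Cons a as)
  have "sat w \<alpha> \<beta> (Bind_Counts v (a # as) \<psi>) \<longleftrightarrow>
      (\<exists>q. of_nat (count_list w a) = q \<and> sat w \<alpha> (\<beta>(v a := q)) (Bind_Counts v as \<psi>))"
    by (simp add: Bind_Counts_def card_positions_eq_count_list[simplified])
  also have "\<dots> \<longleftrightarrow> sat w \<alpha> (\<beta>(v a := \<beta> (v a))) (Bind_Counts v as \<psi>)"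
    using Cons.prems[of a] by simp
  also have "\<dots> \<longleftrightarrow> sat w \<alpha> \<beta> \<psi>"
    unfolding fun_upd_triv using Cons.prems by (intro Cons.IH) simp
  finally show ?case .
qed

lemma foc_formula_Bind_Counts [simp]:
  "foc_formula \<Sigma> (Bind_Counts v as \<psi>) \<longleftrightarrow> set as \<subseteq> \<Sigma> \<and> foc_formula \<Sigma> \<psi>"
  by (induction as) (auto simp: Bind_Counts_def)

lemma free_pvars_Bind_Counts [simp]: "free_pvars (Bind_Counts v as \<psi>) = free_pvars \<psi>"
  by (induction as) (auto simp: Bind_Counts_def)

lemma free_cvars_Bind_Counts [simp]:
  "free_cvars (Bind_Counts v as \<psi>) = free_cvars \<psi> - v ` set as"
  by (induction as) (auto simp: Bind_Counts_def)

theorem proposition9: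
  fixes k :: nat and M :: "'a sscm"
  assumes "is_sscm k M"
  shows "\<exists>\<sigma>. foc_sentence (alphabet M) \<sigma> \<and>
              sscm_recognizes k M (foc_language (alphabet M) \<sigma>)"
proof -
  let ?\<Sigma> = "alphabet M"
  have fin: "finite ?\<Sigma>" using assms by (simp add: is_sscm_def)
  then obtain as where as: "set as = ?\<Sigma>" "distinct as"
    using finite_distinct_list by blast
  \<comment> \<open>Injectivity gives each letter a count variable of its own.\<close>
  obtain v :: "'a \<Rightarrow> nat" where v: "inj_on v ?\<Sigma>"
    using fin finite_imp_inj_to_nat_seg by blast
  define counter where "counter j = CTerm 0 (map (\<lambda>a. (of_int (update M a j), v a)) as)" for j
  define test :: "nat \<Rightarrow> 'a foc" where "test j = (let \<phi> = EqT (counter j) (CTerm 0 []) in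
    if mask M j = 0 then \<phi> else Neg \<phi>)" for j
  define \<sigma> where "\<sigma> = Bind_Counts v as (Conj (map test [1..<Suc k]))"
  have sentence: "foc_sentence ?\<Sigma> \<sigma>"
    using as by (auto simp: foc_sentence_def \<sigma>_def test_def counter_def Let_def)
  have "models w \<sigma> \<longleftrightarrow> sscm_accepts k M w" if w: "w \<in> lists ?\<Sigma>" for w
  proof -
    \<comment> \<open>Inverting \<open>v\<close> recovers the letter from its variable; outside the
      image of \<open>v\<close> the value is unspecified, but no such variable occurs in
      \<open>\<sigma>\<close>.\<close>
    define \<beta> :: "cvar \<Rightarrow> rat" where "\<beta> x = of_nat (count_list w (the_inv_into ?\<Sigma> v x))" for x
    have \<beta>: "\<beta> (v a) = of_nat (count_list w a)" if "a \<in> set as" for a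
      using that as v by (simp add: \<beta>_def the_inv_into_f_f)
    have "eval \<beta> (counter j) = of_int (\<Sum>a\<leftarrow>w. update M a j)" for j
    proof -
      have "eval \<beta> (counter j) = (\<Sum>a\<in>?\<Sigma>. of_int (update M a j) * \<beta> (v a))"
        using as by (simp add: counter_def o_def sum_list_distinct_conv_sum_set)
      also have "\<dots> = of_int (\<Sum>a\<in>?\<Sigma>. of_nat (count_list w a) * update M a j)"
        using \<beta> as by (simp add: mult.commute)
      finally show ?thesis
        using w fin sum_list_map_eq_sum_count_list[of ?\<Sigma> w "\<lambda>a. update M a j"]
        by (metis in_lists_conv_set subsetI)
    qed
    \<comment> \<open>The embedding \<open>of_int\<close> into the rationals is injective, so
      testing for zero there agrees with testing the integer counter.\<close>
    then have "sat w \<alpha> \<beta> (test j) \<longleftrightarrow> ((\<Sum>a\<leftarrow>w. update M a j) = 0 \<longleftrightarrow> mask M j = 0)" for \<alpha> j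
      by (simp add: test_def Let_def)
    moreover have "models w \<sigma> \<longleftrightarrow> sat w (\<lambda>_. 0) \<beta> (Conj (map test [1..<Suc k]))"
      using models_sentence[OF sentence] sat_Bind_Counts[of as \<beta> v w] \<beta> by (metis \<sigma>_def)
    ultimately show ?thesis
      unfolding sscm_accepts_iff_sum_list by auto
  qed
  then have "sscm_recognizes k M (foc_language ?\<Sigma> \<sigma>)"
    by (auto simp: sscm_recognizes_def foc_language_def)
  with sentence show ?thesis by blast
qed

end
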